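(* Let $\mathcal G(\mathcal V,\mathcal E)$ be a single-source acyclic, unit-delay, memory-free network with set of sinks $\mathcal T$, and let $\mathcal G_{inst}$ be the corresponding instantaneous network (the same graph, with no delay associated with the edges). Let $\mathcal N$ be a set of local encoding kernel matrices over $\mathbb F_q$ (one of size $\delta_I(v)\times\delta_O(v)$ for each node $v\in\mathcal V$) describing an $n'$-dimensional network code over $\mathbb F_q$ for $\mathcal G_{inst}$, where $n'$ is at most the min-cut of the source-sink connections in $\mathcal G_{inst}$. Then the network code described by $\mathcal N$ continues to be an $n'$-dimensional network code (over $\mathbb F_q(z)$) for the unit-delay, memory-free network $\mathcal G$. Explicitly: if the $n'\times n'$ matrix $M_T=A(I-K)^{-1}B^{T}$ has full rank over $\mathbb F_q$ for every $T\in\mathcal T$, then the $n'\times n'$ matrix $M_T(z)=A(I-zK)^{-1}B^{T}$ has full rank over $\mathbb F_q(z)$ for every $T\in\mathcal T$.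
   Context: $\mathcal G=(\mathcal V,\mathcal E)$ is a finite acyclic directed multigraph with source $s$ and set of sinks $\mathcal T$; edges $e_1,\dots,e_{|\mathcal E|}$ are in ancestral order. $\Gamma_I(v)$ and $\Gamma_O(v)$ are the sets of incoming and outgoing edges of $v$, $\delta_I(v)=|\Gamma_I(v)|$, $\delta_O(v)=|\Gamma_O(v)|$; $head(e)=v$ if $e\in\Gamma_I(v)$ and $tail(e)=v$ if $e\in\Gamma_O(v)$. Each edge carries one symbol of $\mathbb F_q$ per time instant; in the unit-delay network each edge has one unit of delay, represented by $z$, and internal nodes are memory-free (they send $\mathbb F_q$-linear combinations of the currently received symbols); in the instantaneous network there is no delay. The local kernels are encoded by matrices over $\mathbb F_q$: $A$ ($n'\times|\mathcal E|$, with $A_{i,j}=0$ unless $e_j\in\Gamma_O(s)$, coupling input $i$ with edge $e_j$); $K$ ($|\mathcal E|\times|\mathcal E|$, with $K_{i,j}=0$ unless $head(e_i)=tail(e_j)$, otherwise the local kernel coefficient between $e_i$ and $e_j$); and for each sink $T$ a matrix $B^{T}$ ($|\mathcal E|\times n'$; the superscript denotes the sink) with $B^{T}_{i,j}=0$ unless $e_i\in\Gamma_I(T)$. The network transfer matrix at sink $T$ is $M_T(z)=A(I-zK)^{-1}B^{T}$ in the unit-delay network and $M_T=A(I-K)^{-1}B^{T}$ in the instantaneous network. The kernels form an $n'$-dimensional network code if the network transfer matrix of every sink has full rank $n'$ (over $\mathbb F_q(z)$ for the unit-delay network, over $\mathbb F_q$ for the instantaneous network). *)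

theory Defs
  imports
    "Graph_Theory.Digraph"
    "Jordan_Normal_Form.Gauss_Jordan_Elimination"
    "Jordan_Normal_Form.DL_Rank"
    "HOL-Computational_Algebra.Polynomial_Factorial"
begin

text \<open>
  A \<^typ>\<open>('v, 'e) pre_digraph\<close> may have parallel arcs, so \<^locale>\<open>fin_digraph\<close> is the class of
  finite directed multigraphs. Arcs point from \<^const>\<open>tail\<close> to \<^const>\<open>head\<close>.
  The list \<open>es\<close> enumerates the edges in ancestral order; indices of the
  \<open>|E| \<times> |E|\<close> matrices refer to it and start at 0.
\<close>

locale acyclic_network = fin_digraph G
  for G :: "('v, 'e) pre_digraph" (structure) +
  fixes s :: 'v
    and sinks :: "'v set"
    and es :: "'e list"
  assumes acyclic_G: "acyclic (arcs_ends G)"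
    and source_in_verts: "s \<in> verts G"
    and sinks_subset: "sinks \<subseteq> verts G - {s}"
    and distinct_edges: "distinct es"
    and set_edges: "set es = arcs G"
    and ancestral_order:
      "\<And>i j. \<lbrakk>i < length es; j < length es; head G (es ! i) \<rightarrow>\<^sup>*\<^bsub>G\<^esub> tail G (es ! j)\<rbrakk> \<Longrightarrow> i < j"

definition min_cut :: "('v, 'e) pre_digraph \<Rightarrow> 'v \<Rightarrow> 'v \<Rightarrow> nat" where
  "min_cut G s t =
     Min {card {e \<in> arcs G. tail G e \<in> S \<and> head G e \<notin> S} | S.
            S \<subseteq> verts G \<and> s \<in> S \<and> t \<notin> S}"

text \<open>
  Positions of the edge \<open>es ! i\<close> among the incoming edges of its head, and among the outgoing
  edges of its tail; these index the rows and columns of the local kernel of a node.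
\<close>

definition in_pos :: "('v, 'e) pre_digraph \<Rightarrow> 'e list \<Rightarrow> nat \<Rightarrow> nat" where
  "in_pos G es i = card {k. k < i \<and> head G (es ! k) = head G (es ! i)}"

definition out_pos :: "('v, 'e) pre_digraph \<Rightarrow> 'e list \<Rightarrow> nat \<Rightarrow> nat" where
  "out_pos G es j = card {k. k < j \<and> tail G (es ! k) = tail G (es ! j)}"

definition K_mat :: "('v, 'e) pre_digraph \<Rightarrow> 'e list \<Rightarrow> ('v \<Rightarrow> 'a::zero mat) \<Rightarrow> 'a mat" where
  "K_mat G es N = mat (length es) (length es) (\<lambda>(i, j).
     if head G (es ! i) = tail G (es ! j)
     then N (head G (es ! i)) $$ (in_pos G es i, out_pos G es j)
     else 0)"

text \<open>
  \<open>N v\<close> is the local kernel of node \<open>v\<close> between its real edges, \<open>A\<close> couples the \<open>n\<close> inputs at the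
  source with its outgoing edges, and \<open>B t\<close> couples the incoming edges of the sink \<open>t\<close> with its
  \<open>n\<close> outputs.
\<close>

definition local_kernels ::
  "('v, 'e) pre_digraph \<Rightarrow> 'v \<Rightarrow> 'v set \<Rightarrow> 'e list \<Rightarrow> nat \<Rightarrow>
   'a::zero mat \<Rightarrow> ('v \<Rightarrow> 'a mat) \<Rightarrow> ('v \<Rightarrow> 'a mat) \<Rightarrow> bool" where
  "local_kernels G s sinks es n A N B \<longleftrightarrow>
     (\<forall>v \<in> verts G. N v \<in> carrier_mat (in_degree G v) (out_degree G v)) \<and>
     A \<in> carrier_mat n (length es) \<and>
     (\<forall>i < n. \<forall>j < length es. es ! j \<notin> out_arcs G s \<longrightarrow> A $$ (i, j) = 0) \<and>
     (\<forall>t \<in> sinks. B t \<in> carrier_mat (length es) n \<and>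
        (\<forall>i < length es. \<forall>j < n. es ! i \<notin> in_arcs G t \<longrightarrow> B t $$ (i, j) = 0))"

text \<open>
  In an acyclic network \<open>K\<close> is strictly upper triangular with respect to the ancestral order, so
  both inverses below exist and \<^const>\<open>the\<close> is applied to a proper value.
\<close>

definition transfer_inst :: "'a::field mat \<Rightarrow> 'a mat \<Rightarrow> 'a mat \<Rightarrow> 'a mat" where
  "transfer_inst A K B = A * the (mat_inverse (1\<^sub>m (dim_row K) - K)) * B"

text \<open>The field of rational functions in \<open>z\<close> over \<open>'a\<close> is \<^typ>\<open>'a poly fract\<close>.\<close>

definition const_rat :: "'a::field \<Rightarrow> 'a poly fract" where
  "const_rat a = to_fract [:a:]"

definition z_rat :: "'a::field poly fract" where
  "z_rat = to_fract [:0, 1:]"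

definition transfer_delay :: "'a::field mat \<Rightarrow> 'a mat \<Rightarrow> 'a mat \<Rightarrow> 'a poly fract mat" where
  "transfer_delay A K B =
     map_mat const_rat A
     * the (mat_inverse (1\<^sub>m (dim_row K) - z_rat \<cdot>\<^sub>m map_mat const_rat K))
     * map_mat const_rat B"

definition inst_network_code ::
  "('v, 'e) pre_digraph \<Rightarrow> 'v set \<Rightarrow> 'e list \<Rightarrow> nat \<Rightarrow>
   'a::field mat \<Rightarrow> ('v \<Rightarrow> 'a mat) \<Rightarrow> ('v \<Rightarrow> 'a mat) \<Rightarrow> bool" where
  "inst_network_code G sinks es n A N B \<longleftrightarrow>
     (\<forall>t \<in> sinks. vec_space.rank n (transfer_inst A (K_mat G es N) (B t)) = n)"

definition delay_network_code ::
  "('v, 'e) pre_digraph \<Rightarrow> 'v set \<Rightarrow> 'e list \<Rightarrow> nat \<Rightarrow>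
   'a::field mat \<Rightarrow> ('v \<Rightarrow> 'a mat) \<Rightarrow> ('v \<Rightarrow> 'a mat) \<Rightarrow> bool" where
  "delay_network_code G sinks es n A N B \<longleftrightarrow>
     (\<forall>t \<in> sinks. vec_space.rank n (transfer_delay A (K_mat G es N) (B t)) = n)"

end

theory Submission
  imports Defs "Subresultants.More_Homomorphisms"
begin

text \<open>
  The ancestral order makes \<open>K\<close> strictly upper triangular, so \<open>I - zK\<close> has determinant 1 and its
  adjugate inverts it already over \<open>\<F>\<^sub>q[z]\<close>. Hence \<open>M\<^sub>T(z)\<close> is a polynomial matrix whose value at
  \<open>z = 1\<close> is \<open>M\<^sub>T\<close>. As evaluation is a ring homomorphism, \<open>det M\<^sub>T(z)\<close> takes the nonzero value
  \<open>det M\<^sub>T\<close> at \<open>z = 1\<close> and so is not the zero polynomial.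
\<close>

text \<open>Over any commutative ring, multiplying by the adjugate on either side gives the
  determinant times the identity. With determinant 1 this is an inverse without division, and a ring
  homomorphism preserves it.\<close>

lemma (in comm_ring_hom) map_adj_mat_mult:
  assumes "L \<in> carrier_mat m m" "det L = 1"
  shows "map_mat hom L * map_mat hom (adj_mat L) = 1\<^sub>m m"
    and "map_mat hom (adj_mat L) * map_mat hom L = 1\<^sub>m m"
proof -
  note adj = adj_mat[OF assms(1)]
  have "(1::'a) \<cdot>\<^sub>m 1\<^sub>m m = 1\<^sub>m m"
    by (rule eq_matI) auto
  then show "map_mat hom L * map_mat hom (adj_mat L) = 1\<^sub>m m"
    and "map_mat hom (adj_mat L) * map_mat hom L = 1\<^sub>m m"
    using adj assms
    by (simp_all add: mat_hom_mult[OF assms(1) adj(1), symmetric]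
        mat_hom_mult[OF adj(1) assms(1), symmetric] mat_hom_one)
qed

text \<open>Lets the result of Gauss-Jordan elimination be replaced by an inverse known in closed
  form.\<close>

lemma mat_inverse_unique:
  fixes L :: "'a::field mat"
  assumes L: "L \<in> carrier_mat m m" and R: "R \<in> carrier_mat m m"
    and LR: "L * R = 1\<^sub>m m" and RL: "R * L = 1\<^sub>m m"
  shows "mat_inverse L = Some R"
proof (cases "mat_inverse L")
  case None
  have "L \<in> Units (ring_mat TYPE('a) m undefined)"
    using assms by (auto simp: Units_def ring_mat_def)
  with mat_inverse(1)[OF L None, of undefined] show ?thesis by blast
next
  case (Some R')
  from mat_inverse(2)[OF L this]
  have R': "L * R' = 1\<^sub>m m" "R' \<in> carrier_mat m m" by auto
  have "R = (R * L) * R'"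
    using assoc_mult_mat[OF R L R'(2)] R'(1) R by simp
  with RL R'(2) Some show ?thesis by simp
qed

lemma mat_inverse_map_adj_mat:
  fixes f :: "'b::comm_ring_1 \<Rightarrow> 'c::field"
  assumes "comm_ring_hom f" "L \<in> carrier_mat m m" "det L = 1"
  shows "mat_inverse (map_mat f L) = Some (map_mat f (adj_mat L))"
  using assms adj_mat(1)[OF assms(2)]
  by (intro mat_inverse_unique) (auto intro: comm_ring_hom.map_adj_mat_mult)

text \<open>Both transfer matrices arise from one polynomial matrix: once with \<open>f\<close> as
  evaluation at 1, once as the embedding into the fraction field.\<close>

lemma map_transfer_matrix:
  fixes f :: "'b::comm_ring_1 \<Rightarrow> 'c::field"
  assumes f: "comm_ring_hom f"
    and A: "A \<in> carrier_mat n m" and B: "B \<in> carrier_mat m n"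
    and L: "L \<in> carrier_mat m m" "det L = 1"
  shows "map_mat f A * the (mat_inverse (map_mat f L)) * map_mat f B
    = map_mat f (A * adj_mat L * B)"
proof -
  interpret comm_ring_hom f by (rule f)
  note adj = adj_mat(1)[OF L(1)]
  show ?thesis
    using mat_hom_mult[OF mult_carrier_mat[OF A adj] B] mat_hom_mult[OF A adj]
    by (simp add: mat_inverse_map_adj_mat[OF f L])
qed

lemma (in acyclic_network) K_mat_strictly_upper:
  assumes "i < length es" "j \<le> i"
  shows "K_mat G es N $$ (i, j) = 0"
proof (rule ccontr)
  assume "K_mat G es N $$ (i, j) \<noteq> 0"
  with assms have "head G (es ! i) = tail G (es ! j)"
    by (auto simp: K_mat_def split: if_splits)
  \<comment> \<open>The ancestral order is applied to the empty walk from the head of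
    \<open>es ! i\<close> to the equal tail of \<open>es ! j\<close>; reachability is reflexive only
    on vertices of \<open>G\<close>.\<close>
  moreover have "tail G (es ! j) \<in> verts G"
    using assms set_edges by (metis le_less_trans nth_mem tail_in_verts)
  ultimately have "i < j"
    using ancestral_order[of i j] assms by auto
  with assms show False by simp
qed

theorem lemma1:
  fixes G :: "('v, 'e) pre_digraph"
    and s :: 'v and sinks :: "'v set" and es :: "'e list"
    and n :: nat
    and A :: "'a::{field, finite} mat"
    and N :: "'v \<Rightarrow> 'a mat"
    and B :: "'v \<Rightarrow> 'a mat"
  assumes "acyclic_network G s sinks es"
    and "local_kernels G s sinks es n A N B"
    and "\<forall>t \<in> sinks. n \<le> min_cut G s t"
    and "inst_network_code G sinks es n A N B"
  shows "delay_network_code G sinks es n A N B"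
proof -
  interpret acyclic_network G s sinks es by (rule assms(1))
  define K where "K = K_mat G es N"
  define m where "m = length es"
  define const :: "'a mat \<Rightarrow> 'a poly mat" where "const = map_mat (\<lambda>a. [:a:])"
  define L where "L = 1\<^sub>m m - [:0, 1:] \<cdot>\<^sub>m const K"
  let ?ev = "\<lambda>p :: 'a poly. poly p 1"
  have K: "K \<in> carrier_mat m m"
    by (simp add: K_def K_mat_def m_def)
  then have L: "L \<in> carrier_mat m m"
    by (auto simp: L_def const_def intro!: minus_carrier_mat)
  have K0: "K $$ (i, j) = 0" if "i < m" "j \<le> i" for i j
    using K_mat_strictly_upper that by (simp add: K_def m_def)
  have "upper_triangular L"
    using K K0 by (auto simp: upper_triangular_def L_def const_def)
  \<comment> \<open>The case \<open>j = i\<close> of \<open>K0\<close> removes the term in z from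
    the diagonal.\<close>
  moreover have "diag_mat L = replicate m 1"
    using K K0 by (auto simp: diag_mat_def L_def const_def intro!: nth_equalityI)
  ultimately have det_L: "det L = 1"
    using det_upper_triangular[OF _ L] by simp
  have ev: "comm_ring_hom ?ev"
    by unfold_locales auto
  have fr: "comm_ring_hom (to_fract :: 'a poly \<Rightarrow> 'a poly fract)"
    by unfold_locales
  have L_ev: "map_mat ?ev L = 1\<^sub>m (dim_row K) - K"
    using K by (intro eq_matI) (auto simp: L_def const_def)
  have L_fr: "map_mat to_fract L = 1\<^sub>m (dim_row K) - z_rat \<cdot>\<^sub>m map_mat const_rat K"
    using K by (intro eq_matI)
      (auto simp: L_def const_def z_rat_def const_rat_def simp flip: to_fract_hom.hom_mult)
  have const_ev: "map_mat ?ev (const X) = X" for X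
    by (intro eq_matI) (auto simp: const_def)
  have const_fr: "map_mat to_fract (const X) = map_mat const_rat X" for X
    by (intro eq_matI) (auto simp: const_def const_rat_def)
  show ?thesis
    unfolding delay_network_code_def
  proof
    fix t assume t: "t \<in> sinks"
    \<comment> \<open>The matrix M_T(z), still over the polynomial ring, where z can be
      specialised.\<close>
    define P where "P = const A * adj_mat L * const (B t)"
    have A: "const A \<in> carrier_mat n m" and B: "const (B t) \<in> carrier_mat m n"
      using assms(2) t by (auto simp: local_kernels_def const_def m_def)
    have P: "P \<in> carrier_mat n n"
      using A B adj_mat(1)[OF L] by (simp add: P_def)
    have inst: "transfer_inst A K (B t) = map_mat ?ev P"
      using map_transfer_matrix[OF ev A B L det_L]
      by (simp add: transfer_inst_def L_ev const_ev P_def)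
    have delay: "transfer_delay A K (B t) = map_mat to_fract P"
      using map_transfer_matrix[OF fr A B L det_L]
      by (simp add: transfer_delay_def L_fr const_fr P_def)
    have "vec_space.rank n (map_mat ?ev P) = n"
      using assms(4) t by (simp add: inst_network_code_def K_def flip: inst)
    then have "det (map_mat ?ev P) \<noteq> 0"
      using vec_space.det_rank_iff[of "map_mat ?ev P" n] P by simp
    then have "poly (det P) 1 \<noteq> 0"
      by (simp add: comm_ring_hom.hom_det[OF ev])
    \<comment> \<open>A polynomial with a nonzero value is nonzero, and the embedding into the
      fraction field is injective.\<close>
    then have "det (map_mat to_fract P :: 'a poly fract mat) \<noteq> 0"
      by (auto simp: comm_ring_hom.hom_det[OF fr])
    then show "vec_space.rank n (transfer_delay A (K_mat G es N) (B t)) = n"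
      using vec_space.det_rank_iff[of "map_mat to_fract P" n] P delay
      by (simp add: K_def)
  qed
qed

end
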